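(* For every finite, connected, loopless graph $G$ (parallel edges allowed), the folding number of $G$ equals its chromatic number: $f(G)=\chi(G)$.
   Context: All graphs are finite, undirected, loopless, connected, and may have parallel edges. A graph is complete if there is at least one edge between every pair of distinct vertices. Foldings are defined recursively: $G$ is a folding of itself; and if $G$ is not complete and $G'$ is obtained from $G$ by identifying two vertices at distance exactly $2$ in $G$ (the new vertex is adjacent to every vertex adjacent to either of them, keeping all edges, so parallel edges may arise), then every folding of $G'$ is a folding of $G$. The folding number $f(G)$ is the minimum number of vertices of a complete graph that is a folding of $G$. $\chi(G)$ denotes the chromatic number of $G$. *)

theory Defs
  imports "HOL-Library.Extended_Nat"
begin

record ('v, 'e) mgraph =
  verts :: "'v set"
  edges :: "'e set"
  ends :: "'e \<Rightarrow> 'v set"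

text \<open>Edges are named objects, so parallel edges are distinct edges with the same set of ends.
  The cardinality condition excludes loops.\<close>

locale multigraph =
  fixes G :: "('v, 'e) mgraph"
  assumes finite_verts: "finite (verts G)"
    and finite_edges: "finite (edges G)"
    and ends_in_verts: "e \<in> edges G \<Longrightarrow> ends G e \<subseteq> verts G"
    and card_ends: "e \<in> edges G \<Longrightarrow> card (ends G e) = 2"

definition adj :: "('v, 'e) mgraph \<Rightarrow> 'v \<Rightarrow> 'v \<Rightarrow> bool" where
  "adj G u v \<longleftrightarrow> (\<exists>e\<in>edges G. ends G e = {u, v})"

text \<open>No non-emptiness is required, so the graph without vertices counts as connected.\<close>

definition connected_graph :: "('v, 'e) mgraph \<Rightarrow> bool" where
  "connected_graph G \<longleftrightarrow> (\<forall>u\<in>verts G. \<forall>v\<in>verts G. (adj G)\<^sup>*\<^sup>* u v)"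

definition complete_graph :: "('v, 'e) mgraph \<Rightarrow> bool" where
  "complete_graph G \<longleftrightarrow> (\<forall>u\<in>verts G. \<forall>v\<in>verts G. u \<noteq> v \<longrightarrow> adj G u v)"

text \<open>The relational power \<open>adj G ^^ n\<close> relates the endpoints of walks of length \<open>n\<close>;
  the distance is \<open>\<infinity>\<close> if there is no walk at all.\<close>

definition graph_dist :: "('v, 'e) mgraph \<Rightarrow> 'v \<Rightarrow> 'v \<Rightarrow> enat" where
  "graph_dist G u v = (INF n\<in>{n. (adj G ^^ n) u v}. enat n)"

text \<open>The vertex arising from the identification of \<open>u\<close> and \<open>v\<close> keeps the name \<open>u\<close>.\<close>

definition identify :: "'v \<Rightarrow> 'v \<Rightarrow> ('v, 'e) mgraph \<Rightarrow> ('v, 'e) mgraph" where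
  "identify u v G =
     \<lparr>verts = verts G - {v},
      edges = edges G,
      ends = (\<lambda>e. (\<lambda>x. if x = v then u else x) ` ends G e)\<rparr>"

text \<open>\<open>has_folding G H\<close> means that \<open>H\<close> is a folding of \<open>G\<close>.\<close>

inductive has_folding :: "('v, 'e) mgraph \<Rightarrow> ('v, 'e) mgraph \<Rightarrow> bool" where
  refl: "has_folding G G"
| fold: "\<lbrakk>\<not> complete_graph G; u \<in> verts G; v \<in> verts G; graph_dist G u v = 2;
          has_folding (identify u v G) H\<rbrakk> \<Longrightarrow> has_folding G H"

definition folding_number :: "('v, 'e) mgraph \<Rightarrow> nat" where
  "folding_number G =
     (LEAST n. \<exists>H. has_folding G H \<and> complete_graph H \<and> card (verts H) = n)"

definition proper_colouring :: "('v, 'e) mgraph \<Rightarrow> nat \<Rightarrow> ('v \<Rightarrow> nat) \<Rightarrow> bool" where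
  "proper_colouring G k c \<longleftrightarrow>
     c ` verts G \<subseteq> {..<k} \<and> (\<forall>u\<in>verts G. \<forall>v\<in>verts G. adj G u v \<longrightarrow> c u \<noteq> c v)"

definition chromatic_number :: "('v, 'e) mgraph \<Rightarrow> nat" where
  "chromatic_number G = (LEAST k. \<exists>c. proper_colouring G k c)"

end

theory Submission
  imports Defs
begin

text \<open>Folding never identifies adjacent vertices, so a folding onto a complete graph with \<open>n\<close>
  vertices pulls back to a proper \<open>n\<close>-colouring of \<open>G\<close>. For the other inequality it suffices that a
  connected, incomplete, \<open>k\<close>-colourable graph has a \<open>k\<close>-colouring in which two vertices at
  distance 2 share a colour: identifying them keeps the graph \<open>k\<close>-colourable. If some neighbourhood
  repeats a colour, this is clear. Otherwise every vertex has fewer than \<open>k\<close> neighbours, so any two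
  vertices at distance 2 may be given the same colour and the rest coloured greedily.\<close>

section \<open>Adjacency and distance 2\<close>

lemma adj_sym: "adj G u v \<Longrightarrow> adj G v u"
  unfolding adj_def by (metis insert_commute)

lemma (in multigraph) adj_irrefl: "\<not> adj G u u"
  unfolding adj_def using card_ends by fastforce

lemma (in multigraph) adj_in_verts:
  assumes "adj G u v"
  shows "u \<in> verts G" "v \<in> verts G"
  using assms ends_in_verts unfolding adj_def by fastforce+

lemma graph_dist_eq_2_imp:
  assumes "graph_dist G u v = 2"
  shows "u \<noteq> v" "\<not> adj G u v"
proof -
  \<comment> \<open>The distance is an infimum over walk lengths, so distance 2 excludes walks of
    length 0 (equality) and of length 1 (adjacency).\<close>
  have *: "\<not> (adj G ^^ n) u v" if "n < 2" for n
  proof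
    assume "(adj G ^^ n) u v"
    hence "graph_dist G u v \<le> enat n"
      unfolding graph_dist_def by (auto intro: INF_lower)
    thus False using assms that
      by (simp add: numeral_eq_enat)
  qed
  show "u \<noteq> v" using *[of 0] by auto
  show "\<not> adj G u v" using *[of 1] by auto
qed

lemma graph_dist_eq_2I:
  assumes "u \<noteq> v" "\<not> adj G u v" "adj G u w" "adj G w v"
  shows "graph_dist G u v = 2"
  unfolding graph_dist_def
proof (rule antisym)
  have "(adj G ^^ 2) u v"
    using assms by (auto simp: numeral_2_eq_2)
  thus "(INF n\<in>{n. (adj G ^^ n) u v}. enat n) \<le> 2"
    by (auto intro: INF_lower2 simp: numeral_eq_enat)
next
  show "2 \<le> (INF n\<in>{n. (adj G ^^ n) u v}. enat n)"
  proof (rule INF_greatest)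
    fix n assume n: "n \<in> {n. (adj G ^^ n) u v}"
    have "\<not> (adj G ^^ 0) u v" "\<not> (adj G ^^ 1) u v"
      using assms(1,2) by auto
    hence "n \<noteq> 0" "n \<noteq> 1" using n by (metis mem_Collect_eq)+
    thus "2 \<le> enat n" by (simp add: numeral_eq_enat)
  qed
qed

text \<open>If every two-step walk closed up or had a shortcut, induction along the walk from
  \<open>u\<close> would keep its current endpoint equal to \<open>u\<close> or related to it
  directly. For adjacency, such a pair \<open>a\<close>, \<open>b\<close> is at distance 2.\<close>

lemma rtranclp_shortcut_free_pair:
  assumes "R\<^sup>*\<^sup>* u v" "u \<noteq> v" "\<not> R u v"
  shows "\<exists>a w b. R a w \<and> R w b \<and> a \<noteq> b \<and> \<not> R a b"
proof (rule ccontr)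
  assume none: "\<not> ?thesis"
  from assms(1) have "u = v \<or> R u v"
    by induction (use none in blast)+
  with assms show False by blast
qed

lemma exists_dist_2:
  assumes "multigraph G" "connected_graph G" "\<not> complete_graph G"
  obtains u v where "u \<in> verts G" "v \<in> verts G" "graph_dist G u v = 2"
proof -
  obtain x y where "(adj G)\<^sup>*\<^sup>* x y" "x \<noteq> y" "\<not> adj G x y"
    using assms unfolding connected_graph_def complete_graph_def by blast
  then obtain u w v where "adj G u w" "adj G w v" "u \<noteq> v" "\<not> adj G u v"
    using rtranclp_shortcut_free_pair[of "adj G"] by blast
  thus thesis
    using that[of u v] graph_dist_eq_2I multigraph.adj_in_verts[OF assms(1)] by metis
qed

section \<open>Identification as the quotient map \<open>id(v := u)\<close>\<close>

lemma adj_identify: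
  assumes "adj G a b"
  shows "adj (identify u v G) ((id(v := u)) a) ((id(v := u)) b)"
  using assms unfolding adj_def identify_def by fastforce

lemma (in multigraph) adj_identifyE:
  assumes "adj (identify u v G) a b"
  obtains x y where "adj G x y" "a = (id(v := u)) x" "b = (id(v := u)) y"
proof -
  have f: "(\<lambda>x. if x = v then u else x) = id(v := u)" by auto
  obtain e where e: "e \<in> edges G" "(id(v := u)) ` ends G e = {a, b}"
    using assms unfolding adj_def identify_def f by auto
  obtain x y where xy: "ends G e = {x, y}"
    using card_ends[OF e(1)] by (auto simp: card_2_iff)
  have "adj G x y" using e(1) xy unfolding adj_def by blast
  moreover have "{(id(v := u)) x, (id(v := u)) y} = {a, b}"
    using e(2) unfolding xy by (simp only: image_insert image_empty)
  \<comment> \<open>Ends are unordered, so the preimages may have to be swapped to match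
    \<open>a\<close> and \<open>b\<close>.\<close>
  ultimately show thesis
    using that[of x y] that[of y x] adj_sym[of G x y]
    by (metis doubleton_eq_iff)
qed

text \<open>An edge could become a loop only by joining \<open>u\<close> and \<open>v\<close>, which
  non-adjacency rules out.\<close>

lemma multigraph_identify:
  assumes "multigraph G" "u \<in> verts G" "u \<noteq> v" "\<not> adj G u v"
  shows "multigraph (identify u v G)"
proof -
  interpret multigraph G by fact
  show ?thesis
  proof
    show "finite (verts (identify u v G))" "finite (edges (identify u v G))"
      using finite_verts finite_edges by (simp_all add: identify_def)
  next
    fix e assume "e \<in> edges (identify u v G)"
    hence e: "e \<in> edges G" by (simp add: identify_def)
    show "ends (identify u v G) e \<subseteq> verts (identify u v G)"
      using ends_in_verts[OF e] assms by (auto simp: identify_def)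
    obtain x y where xy: "ends G e = {x, y}" "x \<noteq> y"
      using card_ends[OF e] by (auto simp: card_2_iff)
    have "adj G x y" "adj G y x" using e xy unfolding adj_def by auto
    hence "(if x = v then u else x) \<noteq> (if y = v then u else y)"
      using xy(2) assms(4) by metis
    thus "card (ends (identify u v G) e) = 2"
      unfolding identify_def using xy(1) by (simp del: if_image_distrib)
  qed
qed

lemma connected_identify:
  assumes "connected_graph G"
  shows "connected_graph (identify u v G)"
  unfolding connected_graph_def
proof (intro ballI)
  fix a b assume ab: "a \<in> verts (identify u v G)" "b \<in> verts (identify u v G)"
  have "(adj (identify u v G))\<^sup>*\<^sup>* ((id(v := u)) x) ((id(v := u)) y)"
    if "(adj G)\<^sup>*\<^sup>* x y" for x y
    using that
  proof induction
    case base
    show ?case by (rule rtranclp.rtrancl_refl)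
  next
    case (step y z)
    from step.IH adj_identify[OF step.hyps(2)] show ?case by (rule rtranclp.rtrancl_into_rtrancl)
  qed
  \<comment> \<open>Vertices of the quotient differ from \<open>v\<close>, so the quotient map fixes
    both \<open>a\<close> and \<open>b\<close>.\<close>
  from this[of a b] show "(adj (identify u v G))\<^sup>*\<^sup>* a b"
    using ab assms by (auto simp: identify_def connected_graph_def)
qed

section \<open>Colourings along the quotient map\<close>

lemma (in multigraph) ex_colouring_card_verts:
  "\<exists>c. proper_colouring G (card (verts G)) c"
proof -
  obtain c where "bij_betw c (verts G) {0..<card (verts G)}"
    using ex_bij_betw_finite_nat[OF finite_verts] by blast
  hence "proper_colouring G (card (verts G)) c"
    unfolding proper_colouring_def bij_betw_def
    using adj_irrefl by (auto dest: inj_onD)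
  thus ?thesis by (rule exI[of _ c])
qed

lemma colouring_complete_card_le:
  assumes "complete_graph G" "proper_colouring G k c"
  shows "card (verts G) \<le> k"
proof -
  have "inj_on c (verts G)"
    using assms unfolding complete_graph_def proper_colouring_def inj_on_def by blast
  thus ?thesis
    using assms(2) card_inj_on_le[of c "verts G" "{..<k}"]
    unfolding proper_colouring_def by simp
qed

lemma colouring_of_identify:
  assumes "u \<in> verts G" "v \<in> verts G" "u \<noteq> v"
    and "proper_colouring (identify u v G) k c"
  shows "proper_colouring G k (c \<circ> id(v := u))"
proof -
  let ?f = "id(v := u)"
  have f: "?f x \<in> verts (identify u v G)" if "x \<in> verts G" for x
    using that assms(1,3) by (simp add: identify_def)
  show ?thesis
    unfolding proper_colouring_def
  proof (intro conjI ballI impI)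
    show "(c \<circ> ?f) ` verts G \<subseteq> {..<k}"
      using f assms(4) unfolding proper_colouring_def comp_def by blast
    show "(c \<circ> ?f) x \<noteq> (c \<circ> ?f) y" if "x \<in> verts G" "y \<in> verts G" "adj G x y" for x y
      using f[OF that(1)] f[OF that(2)] adj_identify[OF that(3)] assms(4)
      unfolding proper_colouring_def comp_apply by blast
  qed
qed

text \<open>Since \<open>c\<close> is constant on the fibres of the quotient map, it descends
  unchanged.\<close>

lemma (in multigraph) colouring_identify:
  assumes "u \<in> verts G" "v \<in> verts G" "c u = c v" "proper_colouring G k c"
  shows "proper_colouring (identify u v G) k c"
proof -
  have f: "c ((id(v := u)) x) = c x" for x
    using assms(3) by simp
  have "c a \<noteq> c b" if ab: "adj (identify u v G) a b" for a b
  proof -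
    obtain x y where "adj G x y" "a = (id(v := u)) x" "b = (id(v := u)) y"
      using adj_identifyE[OF ab] .
    thus ?thesis
      using assms(4) adj_in_verts[of x y] f unfolding proper_colouring_def by metis
  qed
  thus ?thesis
    using assms(4) unfolding proper_colouring_def by (auto simp: identify_def)
qed

text \<open>The induction starts from \<open>H\<close> with one colour per vertex and composes with
  one quotient map per identification. Distance 2 enters through distinctness and non-adjacency,
  which keep every intermediate graph loopless.\<close>

lemma folding_colouring:
  assumes "has_folding G H" "multigraph G" "complete_graph H"
  shows "\<exists>c. proper_colouring G (card (verts H)) c"
  using assms
proof induction
  case (refl G)
  show ?case by (rule multigraph.ex_colouring_card_verts) fact
next
  case (fold G u v H)
  note uv = graph_dist_eq_2_imp[OF fold.hyps(4)]
  have "multigraph (identify u v G)"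
    using multigraph_identify[OF fold.prems(1) fold.hyps(2) uv] .
  then obtain c where "proper_colouring (identify u v G) (card (verts H)) c"
    using fold.IH fold.prems(2) by blast
  from colouring_of_identify[OF fold.hyps(2,3) uv(1) this] show ?case
    by (rule exI[of _ "c \<circ> id(v := u)"])
qed

section \<open>Making two vertices at distance 2 share a colour\<close>

text \<open>Extends a proper precolouring \<open>c0\<close> of \<open>P\<close> to \<open>T\<close>,
  one vertex at a time. Fewer than \<open>k\<close> neighbours in all of \<open>V\<close> leave a
  free colour whatever was chosen before.\<close>

lemma greedy_colouring:
  fixes R :: "'a \<Rightarrow> 'a \<Rightarrow> bool" and c0 :: "'a \<Rightarrow> nat"
  assumes "finite V" "finite T" "T \<subseteq> V" "P \<subseteq> V" "T \<inter> P = {}"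
    and sym: "\<And>x y. R x y \<Longrightarrow> R y x" and irrefl: "\<And>x. \<not> R x x"
    and deg: "\<And>x. x \<in> V \<Longrightarrow> card {y \<in> V. R x y} < k"
    and "c0 ` P \<subseteq> {..<k}" "\<forall>x\<in>P. \<forall>y\<in>P. R x y \<longrightarrow> c0 x \<noteq> c0 y"
  shows "\<exists>c. c ` (T \<union> P) \<subseteq> {..<k} \<and> (\<forall>x\<in>P. c x = c0 x) \<and>
    (\<forall>x\<in>T \<union> P. \<forall>y\<in>T \<union> P. R x y \<longrightarrow> c x \<noteq> c y)"
  using assms(2,3,5)
proof induction
  case empty
  thus ?case using assms(9,10) by (intro exI[of _ c0]) auto
next
  case (insert t T)
  then obtain c where c: "c ` (T \<union> P) \<subseteq> {..<k}" "\<forall>x\<in>P. c x = c0 x"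
      "\<forall>x\<in>T \<union> P. \<forall>y\<in>T \<union> P. R x y \<longrightarrow> c x \<noteq> c y"
    by auto
  \<comment> \<open>The map \<open>c\<close> is total, so this image may include arbitrary values at
    neighbours outside \<open>T \<union> P\<close>; the degree bound already allows for
    them.\<close>
  have "card (c ` {y \<in> V. R t y}) < card {..<k}"
    using card_image_le[of "{y \<in> V. R t y}" c] deg[of t] insert.prems \<open>finite V\<close> by simp
  hence "\<not> {..<k} \<subseteq> c ` {y \<in> V. R t y}"
    using card_mono[of "c ` {y \<in> V. R t y}" "{..<k}"] \<open>finite V\<close> by fastforce
  then obtain i where i: "i < k" "i \<notin> c ` {y \<in> V. R t y}" by blast
  have free: "(R t x \<longrightarrow> i \<noteq> c x) \<and> (R x t \<longrightarrow> c x \<noteq> i)" if "x \<in> T \<union> P" for x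
    using that i insert.prems \<open>P \<subseteq> V\<close> sym by blast
  have "t \<notin> T \<union> P" using insert by auto
  hence "(c(t := i)) ` (insert t T \<union> P) \<subseteq> {..<k} \<and> (\<forall>x\<in>P. (c(t := i)) x = c0 x) \<and>
    (\<forall>x\<in>insert t T \<union> P. \<forall>y\<in>insert t T \<union> P. R x y \<longrightarrow> (c(t := i)) x \<noteq> (c(t := i)) y)"
    using c i(1) free irrefl by (simp add: image_subset_iff)
  thus ?case by blast
qed

lemma ex_dist_2_same_colour:
  assumes "multigraph G" "connected_graph G" "\<not> complete_graph G" "proper_colouring G k c"
  shows "\<exists>u\<in>verts G. \<exists>v\<in>verts G. graph_dist G u v = 2 \<and>
    (\<exists>c'. proper_colouring G k c' \<and> c' u = c' v)"
proof (cases "\<forall>w\<in>verts G. inj_on c {y \<in> verts G. adj G w y}")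
  interpret multigraph G by fact
  \<comment> \<open>Two neighbours of \<open>w\<close> with equal colours are non-adjacent because
    \<open>c\<close> is proper, hence at distance 2 through \<open>w\<close>.\<close>
  case False
  then obtain w u v where "adj G w u" "adj G w v" "u \<noteq> v" "c u = c v"
      "u \<in> verts G" "v \<in> verts G"
    unfolding inj_on_def by blast
  thus ?thesis
    using assms(4) graph_dist_eq_2I[of u v G w] adj_sym[of G w u]
    unfolding proper_colouring_def by metis
next
  interpret multigraph G by fact
  case True
  have deg: "card {y \<in> verts G. adj G x y} < k" if x: "x \<in> verts G" for x
  proof -
    \<comment> \<open>The neighbours of \<open>x\<close> have pairwise distinct colours and none has
      the colour of \<open>x\<close>, which leaves at most \<open>k - 1\<close> of them.\<close>
    have "c ` {y \<in> verts G. adj G x y} \<subseteq> {..<k} - {c x}" "c x < k"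
      using assms(4) x unfolding proper_colouring_def by force+
    thus ?thesis
      using True x card_inj_on_le[of c "{y \<in> verts G. adj G x y}" "{..<k} - {c x}"] by force
  qed
  obtain u v where uv: "u \<in> verts G" "v \<in> verts G" "graph_dist G u v = 2"
    using exists_dist_2[OF assms(1-3)] .
  have k: "c u < k"
    using assms(4) uv(1) unfolding proper_colouring_def by blast
  have non: "\<not> adj G u v" "\<not> adj G v u"
    using graph_dist_eq_2_imp(2)[OF uv(3)] adj_sym[of G v u] by blast+
  \<comment> \<open>The precoloured set is \<open>{u, v}\<close> with constant colour
    \<open>c u\<close>, proper because \<open>u\<close> and \<open>v\<close> are not
    adjacent.\<close>
  have "\<exists>c'. c' ` (verts G - {u, v} \<union> {u, v}) \<subseteq> {..<k} \<and> (\<forall>x\<in>{u, v}. c' x = c u) \<and>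
    (\<forall>x\<in>verts G - {u, v} \<union> {u, v}. \<forall>y\<in>verts G - {u, v} \<union> {u, v}.
      adj G x y \<longrightarrow> c' x \<noteq> c' y)"
    by (rule greedy_colouring[of "verts G" _ _ "adj G"])
      (use finite_verts uv k non deg adj_sym adj_irrefl in auto)
  moreover have "verts G - {u, v} \<union> {u, v} = verts G" using uv by blast
  ultimately obtain c' where "proper_colouring G k c'" "\<forall>x\<in>{u, v}. c' x = c u"
    unfolding proper_colouring_def by metis
  hence "proper_colouring G k c'" "c' u = c' v" by simp_all
  thus ?thesis using uv by blast
qed

section \<open>Complete foldings and the equality\<close>

text \<open>Each identification removes a vertex and, for an equally coloured pair at distance 2,
  preserves the hypotheses. On the final complete graph the colouring is injective but may miss
  colours, hence the inequality.\<close>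

lemma colouring_folding:
  assumes "multigraph G" "connected_graph G" "proper_colouring G k c"
  shows "\<exists>H. has_folding G H \<and> complete_graph H \<and> card (verts H) \<le> k"
  using assms
proof (induction "card (verts G)" arbitrary: G c rule: less_induct)
  case less
  show ?case
  proof (cases "complete_graph G")
    case True
    thus ?thesis using has_folding.refl colouring_complete_card_le less.prems by blast
  next
    case False
    then obtain u v c' where uv: "u \<in> verts G" "v \<in> verts G" "graph_dist G u v = 2"
      and c': "proper_colouring G k c'" "c' u = c' v"
      using ex_dist_2_same_colour less.prems by blast
    let ?G = "identify u v G"
    have "card (verts ?G) < card (verts G)"
      using uv(2) multigraph.finite_verts[OF less.prems(1)]
      by (simp add: identify_def card_Diff1_less del: card_Diff_insert)
    moreover have "multigraph ?G"
      using multigraph_identify[OF less.prems(1) uv(1)] graph_dist_eq_2_imp[OF uv(3)] by blast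
    moreover have "proper_colouring ?G k c'"
      using multigraph.colouring_identify[OF less.prems(1) uv(1,2) c'(2,1)] .
    ultimately obtain H where "has_folding ?G H" "complete_graph H" "card (verts H) \<le> k"
      using less.hyps connected_identify[OF less.prems(2)] by blast
    thus ?thesis using has_folding.fold[OF False uv] by blast
  qed
qed

theorem theorem1:
  fixes G :: "('v, 'e) mgraph"
  assumes "multigraph G"
    and "connected_graph G"
  shows "folding_number G = chromatic_number G"
proof (rule antisym)
  let ?P = "\<lambda>n. \<exists>H. has_folding G H \<and> complete_graph H \<and> card (verts H) = n"
  have "\<exists>c. proper_colouring G (chromatic_number G) c"
    unfolding chromatic_number_def
    by (rule LeastI_ex) (use multigraph.ex_colouring_card_verts[OF assms(1)] in blast)
  then obtain H where H: "has_folding G H" "complete_graph H"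
      "card (verts H) \<le> chromatic_number G"
    using colouring_folding[OF assms] by blast
  have "folding_number G \<le> card (verts H)"
    unfolding folding_number_def by (rule Least_le) (use H in blast)
  thus "folding_number G \<le> chromatic_number G" using H(3) by simp
  \<comment> \<open>The complete folding found for the first inequality ensures that the minimum
    defining \<open>folding_number\<close> is attained.\<close>
  have "?P (folding_number G)"
    unfolding folding_number_def by (rule LeastI_ex) (use H in blast)
  then obtain c where "proper_colouring G (folding_number G) c"
    using folding_colouring[OF _ assms(1)] by metis
  thus "chromatic_number G \<le> folding_number G"
    unfolding chromatic_number_def by (blast intro: Least_le)
qed

end
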